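(* Let $p$ be an odd prime and $k\ge 1$ an integer. If $m_1,m_2\in\mathbb{Z}_{p^k}$ satisfy $v_p(m_1)=v_p(m_2)$, then $$a_{p^k}(m_1)=a_{p^k}(m_2).$$
   Context: $\mathbb{Z}_{p^k}=\mathbb{Z}/p^k\mathbb{Z}$. For a commutative unital ring $R$, $\mathcal{H}_R=\{w+xi+yj+zk: w,x,y,z\in R\}$ is the quaternion ring over $R$ (with $i^2=j^2=k^2=ijk=-1$), with norm $N(w+xi+yj+zk)=w^2+x^2+y^2+z^2$. For $m\in\mathbb{Z}_{p^k}$, $a_{p^k}(m)=|\{q\in\mathcal{H}_{\mathbb{Z}_{p^k}}:N(q)=m\}|$. The $p$-adic valuation $v_p$ on $\mathbb{Z}_{p^k}$: for $m\neq 0$ with integer representative $a\in\{1,\dots,p^k-1\}$, $v_p(m)=\max\{t\ge 0: p^t\mid a\}$, and $v_p(0)=k$. *)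

theory Defs
  imports "HOL-Number_Theory.Number_Theory"
begin

datatype 'a quaternion = Quaternion (re: 'a) (im_i: 'a) (im_j: 'a) (im_k: 'a)

(* The multiplication is the bilinear extension of i^2 = j^2 = k^2 = ijk = -1. *)
definition quaternion_ring :: "('a, 'b) ring_scheme \<Rightarrow> 'a quaternion ring" where
  "quaternion_ring R =
    \<lparr>carrier = {Quaternion w x y z | w x y z.
        w \<in> carrier R \<and> x \<in> carrier R \<and> y \<in> carrier R \<and> z \<in> carrier R},
     mult = (\<lambda>q r. Quaternion
        (re q \<otimes>\<^bsub>R\<^esub> re r \<ominus>\<^bsub>R\<^esub> im_i q \<otimes>\<^bsub>R\<^esub> im_i r \<ominus>\<^bsub>R\<^esub> im_j q \<otimes>\<^bsub>R\<^esub> im_j r \<ominus>\<^bsub>R\<^esub> im_k q \<otimes>\<^bsub>R\<^esub> im_k r)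
        (re q \<otimes>\<^bsub>R\<^esub> im_i r \<oplus>\<^bsub>R\<^esub> im_i q \<otimes>\<^bsub>R\<^esub> re r \<oplus>\<^bsub>R\<^esub> im_j q \<otimes>\<^bsub>R\<^esub> im_k r \<ominus>\<^bsub>R\<^esub> im_k q \<otimes>\<^bsub>R\<^esub> im_j r)
        (re q \<otimes>\<^bsub>R\<^esub> im_j r \<ominus>\<^bsub>R\<^esub> im_i q \<otimes>\<^bsub>R\<^esub> im_k r \<oplus>\<^bsub>R\<^esub> im_j q \<otimes>\<^bsub>R\<^esub> re r \<oplus>\<^bsub>R\<^esub> im_k q \<otimes>\<^bsub>R\<^esub> im_i r)
        (re q \<otimes>\<^bsub>R\<^esub> im_k r \<oplus>\<^bsub>R\<^esub> im_i q \<otimes>\<^bsub>R\<^esub> im_j r \<ominus>\<^bsub>R\<^esub> im_j q \<otimes>\<^bsub>R\<^esub> im_i r \<oplus>\<^bsub>R\<^esub> im_k q \<otimes>\<^bsub>R\<^esub> re r)),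
     one = Quaternion \<one>\<^bsub>R\<^esub> \<zero>\<^bsub>R\<^esub> \<zero>\<^bsub>R\<^esub> \<zero>\<^bsub>R\<^esub>,
     zero = Quaternion \<zero>\<^bsub>R\<^esub> \<zero>\<^bsub>R\<^esub> \<zero>\<^bsub>R\<^esub> \<zero>\<^bsub>R\<^esub>,
     add = (\<lambda>q r. Quaternion (re q \<oplus>\<^bsub>R\<^esub> re r) (im_i q \<oplus>\<^bsub>R\<^esub> im_i r)
        (im_j q \<oplus>\<^bsub>R\<^esub> im_j r) (im_k q \<oplus>\<^bsub>R\<^esub> im_k r))\<rparr>"

definition quaternion_norm :: "('a, 'b) ring_scheme \<Rightarrow> 'a quaternion \<Rightarrow> 'a" where
  "quaternion_norm R q =
     re q [^]\<^bsub>R\<^esub> (2::nat) \<oplus>\<^bsub>R\<^esub> im_i q [^]\<^bsub>R\<^esub> (2::nat) \<oplus>\<^bsub>R\<^esub> im_j q [^]\<^bsub>R\<^esub> (2::nat) \<oplus>\<^bsub>R\<^esub> im_k q [^]\<^bsub>R\<^esub> (2::nat)"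

(* The elements of Z/p^kZ are the integers 0, ..., p^k - 1, the carrier of residue_ring (p^k). *)
definition norm_count :: "nat \<Rightarrow> nat \<Rightarrow> int \<Rightarrow> nat" where
  "norm_count p k m =
     card {q \<in> carrier (quaternion_ring (residue_ring (int p ^ k))).
             quaternion_norm (residue_ring (int p ^ k)) q = m}"

(* Meant for m in {0, ..., p^k - 1}. *)
definition residue_val :: "nat \<Rightarrow> nat \<Rightarrow> int \<Rightarrow> nat" where
  "residue_val p k m = (if m = 0 then k else multiplicity (int p) m)"

lemma (in cring) quaternion_ring_is_ring: "ring (quaternion_ring R)"
proof (rule ringI)
  show "abelian_group (quaternion_ring R)"
  proof (rule abelian_groupI)
    fix x assume "x \<in> carrier (quaternion_ring R)"
    then show "\<exists>y\<in>carrier (quaternion_ring R). y \<oplus>\<^bsub>quaternion_ring R\<^esub> x = \<zero>\<^bsub>quaternion_ring R\<^esub>"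
      by (intro bexI[of _ "Quaternion (\<ominus> re x) (\<ominus> im_i x) (\<ominus> im_j x) (\<ominus> im_k x)"])
        (auto simp: quaternion_ring_def l_neg)
  qed (auto simp: quaternion_ring_def a_ac)
  show "monoid (quaternion_ring R)"
  proof (rule monoidI)
    fix x y z assume "x \<in> carrier (quaternion_ring R)" "y \<in> carrier (quaternion_ring R)"
      "z \<in> carrier (quaternion_ring R)"
    then show "x \<otimes>\<^bsub>quaternion_ring R\<^esub> y \<otimes>\<^bsub>quaternion_ring R\<^esub> z
      = x \<otimes>\<^bsub>quaternion_ring R\<^esub> (y \<otimes>\<^bsub>quaternion_ring R\<^esub> z)"
      by (auto simp: quaternion_ring_def minus_eq l_distr r_distr minus_add l_minus r_minus m_assoc a_ac)
  qed (auto simp: quaternion_ring_def minus_eq)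
qed (auto simp: quaternion_ring_def minus_eq l_distr r_distr minus_add l_minus r_minus a_ac)

lemma (in cring) quaternion_units:
  defines "H \<equiv> quaternion_ring R"
  defines "i \<equiv> Quaternion \<zero> \<one> \<zero> \<zero>"
    and "j \<equiv> Quaternion \<zero> \<zero> \<one> \<zero>"
    and "k \<equiv> Quaternion \<zero> \<zero> \<zero> \<one>"
  shows "i \<otimes>\<^bsub>H\<^esub> i = \<ominus>\<^bsub>H\<^esub> \<one>\<^bsub>H\<^esub>" "j \<otimes>\<^bsub>H\<^esub> j = \<ominus>\<^bsub>H\<^esub> \<one>\<^bsub>H\<^esub>"
    "k \<otimes>\<^bsub>H\<^esub> k = \<ominus>\<^bsub>H\<^esub> \<one>\<^bsub>H\<^esub>" "i \<otimes>\<^bsub>H\<^esub> j \<otimes>\<^bsub>H\<^esub> k = \<ominus>\<^bsub>H\<^esub> \<one>\<^bsub>H\<^esub>"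
proof -
  interpret H: ring H unfolding H_def by (rule quaternion_ring_is_ring)
  have "\<ominus>\<^bsub>H\<^esub> \<one>\<^bsub>H\<^esub> = Quaternion (\<ominus> \<one>) \<zero> \<zero> \<zero>"
    by (rule H.minus_equality) (auto simp: H_def quaternion_ring_def l_neg)
  then show "i \<otimes>\<^bsub>H\<^esub> i = \<ominus>\<^bsub>H\<^esub> \<one>\<^bsub>H\<^esub>" "j \<otimes>\<^bsub>H\<^esub> j = \<ominus>\<^bsub>H\<^esub> \<one>\<^bsub>H\<^esub>"
    "k \<otimes>\<^bsub>H\<^esub> k = \<ominus>\<^bsub>H\<^esub> \<one>\<^bsub>H\<^esub>" "i \<otimes>\<^bsub>H\<^esub> j \<otimes>\<^bsub>H\<^esub> k = \<ominus>\<^bsub>H\<^esub> \<one>\<^bsub>H\<^esub>"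
    by (simp_all add: H_def i_def j_def k_def quaternion_ring_def minus_eq)
qed

end

theory Submission
  imports Defs
begin

text \<open>Elements of equal valuation differ by a unit factor, and modulo an odd prime power every unit
  is a sum of two squares \<open>c\<^sup>2 + d\<^sup>2\<close>: modulo \<open>p\<close> by the pigeonhole principle, modulo \<open>p\<^sup>k\<close> by
  Hensel lifting. Left multiplication by \<open>c + di\<close> is then an injection from the quaternions of norm
  \<open>m\<close> to those of norm \<open>(c\<^sup>2 + d\<^sup>2) m\<close>. By symmetry the two counts agree.\<close>

text \<open>\<open>p\<close> divides \<open>(a - b) * (a + b)\<close>, hence one of the factors. On
  this range both are smaller than \<open>p\<close> in absolute value, so that factor is 0;
  \<open>a + b = 0\<close> forces both to be 0.\<close>

lemma inj_on_square_mod_prime: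
  fixes p :: int
  assumes "prime p"
  shows "inj_on (\<lambda>a. a\<^sup>2 mod p) {0..(p - 1) div 2}"
proof (rule inj_onI)
  fix a b assume a: "a \<in> {0..(p - 1) div 2}" and b: "b \<in> {0..(p - 1) div 2}"
    and eq: "a\<^sup>2 mod p = b\<^sup>2 mod p"
  have "p dvd (a - b) * (a + b)"
    using eq by (simp add: mod_eq_dvd_iff power2_eq_square algebra_simps)
  then consider "p dvd a - b" | "p dvd a + b"
    using assms prime_dvd_mult_iff by blast
  then show "a = b"
  proof cases
    case 1
    with a b show ?thesis
      using dvd_imp_le_int[of "a - b" p] prime_gt_1_int[OF assms] by (cases "a = b") auto
  next
    case 2
    with a b show ?thesis
      using zdvd_imp_le[of p "a + b"] prime_gt_1_int[OF assms] by (cases "a + b = 0") auto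
  qed
qed

text \<open>The residues of \<open>a^2\<close> and those of \<open>u - b^2\<close> form two sets of
  (p + 1)/2 elements each. Together that is p + 1 > p, so the sets meet.\<close>

lemma sum_two_squares_mod_prime:
  fixes p u :: int
  assumes "prime p" "odd p"
  shows "\<exists>a b. [a\<^sup>2 + b\<^sup>2 = u] (mod p)"
proof -
  define I where "I = {0..(p - 1) div 2}"
  define A where "A = (\<lambda>a. a\<^sup>2 mod p) ` I"
  define B where "B = (\<lambda>b. (u - b\<^sup>2) mod p) ` I"
  have p1: "p > 1" using assms(1) by (rule prime_gt_1_int)
  have inj: "inj_on (\<lambda>a. a\<^sup>2 mod p) I"
    unfolding I_def using assms(1) by (rule inj_on_square_mod_prime)
  have "inj_on (\<lambda>b. (u - b\<^sup>2) mod p) I"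
  proof (rule inj_onI)
    fix a b assume ab: "a \<in> I" "b \<in> I" and "(u - a\<^sup>2) mod p = (u - b\<^sup>2) mod p"
    then have "p dvd b\<^sup>2 - a\<^sup>2" by (simp add: mod_eq_dvd_iff)
    then have "a\<^sup>2 mod p = b\<^sup>2 mod p" by (metis mod_eq_dvd_iff)
    with inj ab show "a = b" by (auto dest: inj_onD)
  qed
  with inj have cards: "card A = card I" "card B = card I"
    unfolding A_def B_def by (simp_all add: card_image)
  have "A \<inter> B \<noteq> {}"
  proof
    assume "A \<inter> B = {}"
    then have "card (A \<union> B) = 2 * card I"
      using cards by (simp add: card_Un_disjoint A_def B_def I_def)
    moreover have "A \<union> B \<subseteq> {0..<p}" using p1 by (auto simp: A_def B_def)
    then have "card (A \<union> B) \<le> nat p" using card_mono[of "{0..<p}" "A \<union> B"] by simp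
    moreover have "2 * card I > nat p"
      using p1 assms(2) by (auto simp: I_def elim!: oddE)
    ultimately show False by simp
  qed
  then obtain a b where "a\<^sup>2 mod p = (u - b\<^sup>2) mod p" by (auto simp: A_def B_def)
  then have "[a\<^sup>2 + b\<^sup>2 = u] (mod p)" by (simp add: cong_iff_dvd_diff mod_eq_dvd_iff algebra_simps)
  then show ?thesis by blast
qed

lemma sum_two_squares_mod_prime_power:
  fixes p u :: int
  assumes "prime p" "odd p" "\<not> p dvd u"
  shows "\<exists>a b. [a\<^sup>2 + b\<^sup>2 = u] (mod p ^ k)"
proof -
  \<comment> \<open>Only \<open>a\<close> is lifted and \<open>b\<close> stays fixed. The extra
    claim \<open>\<not> p dvd a\<close> keeps the derivative \<open>2 * a\<close> invertible modulo
    \<open>p\<close>; it is available from exponent 1 on, hence \<open>Suc k\<close>.\<close>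
  have "\<exists>a b. \<not> p dvd a \<and> [a\<^sup>2 + b\<^sup>2 = u] (mod p ^ Suc k)" for k
  proof (induction k)
    case 0
    obtain a b where ab: "[a\<^sup>2 + b\<^sup>2 = u] (mod p)"
      using sum_two_squares_mod_prime assms by blast
    \<comment> \<open>Otherwise \<open>p\<close> would divide \<open>u\<close>. Swapping the
      summands if necessary makes the first one prime to \<open>p\<close>.\<close>
    then have "\<not> (p dvd a \<and> p dvd b)"
      using assms(3) by (auto simp: power2_eq_square cong_dvd_iff[symmetric])
    with ab show ?case by (metis add.commute power_one_right One_nat_def)
  next
    case (Suc k)
    then obtain a b where a: "\<not> p dvd a" and ab: "[a\<^sup>2 + b\<^sup>2 = u] (mod p ^ Suc k)" by blast
    then obtain s where s: "u - (a\<^sup>2 + b\<^sup>2) = p ^ Suc k * s"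
      by (metis cong_iff_dvd_diff cong_sym dvdE)
    have "coprime (2 * a) p"
      using a assms prime_imp_coprime[of p a] primes_coprime[of p 2]
      by (auto simp: coprime_commute)
    then obtain v where v: "[2 * a * v = 1] (mod p)"
      using cong_solve_coprime_int by blast
    \<comment> \<open>Newton step: \<open>t\<close> solves 2at = s modulo \<open>p\<close>, so
      adding \<open>p ^ Suc k * t\<close> to \<open>a\<close> cancels the error
      \<open>p ^ Suc k * s\<close> up to a multiple of \<open>p ^ Suc (Suc k)\<close>. The quadratic
      term is divisible by that power as well.\<close>
    define t where "t = v * s"
    have "[2 * a * v * s = 1 * s] (mod p)" using v by (rule cong_scalar_right)
    then obtain r where r: "2 * a * t - s = p * r"
      by (auto simp: t_def cong_iff_dvd_diff mult.assoc)
    have "(a + p ^ Suc k * t)\<^sup>2 + b\<^sup>2 - u = p ^ Suc k * (2 * a * t - s) + (p ^ Suc k * t)\<^sup>2"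
      using s by (simp add: power2_eq_square algebra_simps)
    also have "\<dots> = p ^ Suc (Suc k) * (r + p ^ k * t\<^sup>2)"
      unfolding r by (simp add: power2_eq_square algebra_simps)
    finally have "[(a + p ^ Suc k * t)\<^sup>2 + b\<^sup>2 = u] (mod p ^ Suc (Suc k))"
      by (simp add: cong_iff_dvd_diff)
    moreover have "\<not> p dvd a + p ^ Suc k * t"
      using a by (simp add: dvd_add_left_iff mult.assoc)
    ultimately show ?case by blast
  qed
  moreover have "[a\<^sup>2 + b\<^sup>2 = u] (mod p ^ k)" if "[a\<^sup>2 + b\<^sup>2 = u] (mod p ^ Suc k)" for a b
    using that by (rule cong_dvd_modulus) simp
  ultimately show ?thesis by blast
qed

text \<open>Replaces ring operations by integer arithmetic on reduced representatives, so that the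
  counting argument can work with congruences.\<close>

lemma (in residues) quaternion_norm_set_eq:
  "{q \<in> carrier (quaternion_ring R). quaternion_norm R q = l} =
   {Quaternion w x y z | w x y z. {w, x, y, z} \<subseteq> {0..<m} \<and> (w\<^sup>2 + x\<^sup>2 + y\<^sup>2 + z\<^sup>2) mod m = l}"
proof -
  have "a [^] (2::nat) = a\<^sup>2 mod m" if "a \<in> {0..<m}" for a
    using that pow_cong[of a 2] by simp
  then have "quaternion_norm R (Quaternion w x y z) = (w\<^sup>2 + x\<^sup>2 + y\<^sup>2 + z\<^sup>2) mod m"
    if "{w, x, y, z} \<subseteq> {0..<m}" for w x y z
    using that by (simp add: quaternion_norm_def res_add_eq mod_simps)
  moreover have "carrier (quaternion_ring R) =
      {Quaternion w x y z | w x y z. {w, x, y, z} \<subseteq> {0..<m}}"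
    using m_gt_one by (auto simp: quaternion_ring_def res_carrier_eq)
  ultimately show ?thesis by auto
qed

text \<open>The two expressions are the real and imaginary parts of (c + di)(w + xi). Multiplying by
  the conjugate c - di leaves \<open>c^2 + d^2\<close> times w + xi, and that factor is a unit
  modulo \<open>n\<close>.\<close>

lemma rotation_cong_cancel:
  fixes c d n :: int
  assumes n: "coprime (c\<^sup>2 + d\<^sup>2) n"
    and 1: "[c * w - d * x = c * w' - d * x'] (mod n)"
    and 2: "[d * w + c * x = d * w' + c * x'] (mod n)"
  shows "[w = w'] (mod n)" "[x = x'] (mod n)"
proof -
  have "[c * (c * w - d * x) + d * (d * w + c * x) =
         c * (c * w' - d * x') + d * (d * w' + c * x')] (mod n)"
    by (rule cong_add[OF cong_scalar_left[OF 1] cong_scalar_left[OF 2]])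
  then have "[(c\<^sup>2 + d\<^sup>2) * w = (c\<^sup>2 + d\<^sup>2) * w'] (mod n)"
    by (simp add: power2_eq_square algebra_simps)
  then show "[w = w'] (mod n)" using n by (simp add: cong_mult_lcancel)
  have "[c * (d * w + c * x) - d * (c * w - d * x) =
         c * (d * w' + c * x') - d * (c * w' - d * x')] (mod n)"
    by (rule cong_diff[OF cong_scalar_left[OF 2] cong_scalar_left[OF 1]])
  then have "[(c\<^sup>2 + d\<^sup>2) * x = (c\<^sup>2 + d\<^sup>2) * x'] (mod n)"
    by (simp add: power2_eq_square algebra_simps)
  then show "[x = x'] (mod n)" using n by (simp add: cong_mult_lcancel)
qed

lemma card_norm_le_of_sum_two_squares:
  fixes c d n :: int
  assumes n: "n > 0" and cop: "coprime (c\<^sup>2 + d\<^sup>2) n" and l: "[(c\<^sup>2 + d\<^sup>2) * l = l'] (mod n)"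
    and l': "l' \<in> {0..<n}"
  defines "S \<equiv> \<lambda>l. {Quaternion w x y z | w x y z.
      {w, x, y, z} \<subseteq> {0..<n} \<and> (w\<^sup>2 + x\<^sup>2 + y\<^sup>2 + z\<^sup>2) mod n = l}"
  shows "card (S l) \<le> card (S l')"
proof (rule card_inj_on_le)
  \<comment> \<open>Left multiplication by c + di, reduced modulo \<open>n\<close>. As ij = k and ik
    = -j, it acts on the coordinate pairs (1, i) and (j, k) by the same matrix, so one cancellation
    lemma serves both.\<close>
  define f where "f = (\<lambda>q. Quaternion ((c * re q - d * im_i q) mod n) ((d * re q + c * im_i q) mod n)
    ((c * im_j q - d * im_k q) mod n) ((d * im_j q + c * im_k q) mod n))"
  show "inj_on f (S l)"
  proof (rule inj_onI)
    fix q q' assume q: "q \<in> S l" "q' \<in> S l" and eq: "f q = f q'"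
    have "[re q = re q'] (mod n)" "[im_i q = im_i q'] (mod n)"
      using eq rotation_cong_cancel[OF cop, of "re q" "im_i q" "re q'" "im_i q'"]
      by (simp_all add: f_def cong_def)
    moreover have "[im_j q = im_j q'] (mod n)" "[im_k q = im_k q'] (mod n)"
      using eq rotation_cong_cancel[OF cop, of "im_j q" "im_k q" "im_j q'" "im_k q'"]
      by (simp_all add: f_def cong_def)
    \<comment> \<open>Coordinates are reduced representatives, so congruent ones are equal.\<close>
    moreover have "re r mod n = re r" "im_i r mod n = im_i r"
      "im_j r mod n = im_j r" "im_k r mod n = im_k r" if "r \<in> S l" for r
      using that by (auto simp: S_def)
    ultimately show "q = q'" using q by (metis cong_def quaternion.expand)
  qed
  show "f ` S l \<subseteq> S l'"
  proof
    fix q' assume "q' \<in> f ` S l"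
    then obtain w x y z where q': "q' = f (Quaternion w x y z)"
      and norm: "(w\<^sup>2 + x\<^sup>2 + y\<^sup>2 + z\<^sup>2) mod n = l" by (auto simp: S_def)
    have "(((c * w - d * x) mod n)\<^sup>2 + ((d * w + c * x) mod n)\<^sup>2
        + ((c * y - d * z) mod n)\<^sup>2 + ((d * y + c * z) mod n)\<^sup>2) mod n
      = ((c * w - d * x)\<^sup>2 + (d * w + c * x)\<^sup>2 + (c * y - d * z)\<^sup>2 + (d * y + c * z)\<^sup>2) mod n"
      unfolding cong_def[symmetric] by (intro cong_add cong_pow) (simp_all only: cong_mod_left cong_refl)
    \<comment> \<open>The two-square identity, applied once to (w, x) and once to (y, z).\<close>
    also have "\<dots> = ((c\<^sup>2 + d\<^sup>2) * (w\<^sup>2 + x\<^sup>2 + y\<^sup>2 + z\<^sup>2)) mod n"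
      by (rule arg_cong[where f = "\<lambda>x. x mod n"]) (simp add: power2_eq_square algebra_simps)
    also have "\<dots> = ((c\<^sup>2 + d\<^sup>2) * l) mod n" unfolding norm[symmetric] by (rule mod_mult_right_eq[symmetric])
    also have "\<dots> = l'" using l l' by (simp add: cong_def)
    finally show "q' \<in> S l'" using n by (auto simp: S_def f_def q')
  qed
  have "S l' \<subseteq> (\<Union>w\<in>{0..<n}. \<Union>x\<in>{0..<n}. \<Union>y\<in>{0..<n}. Quaternion w x y ` {0..<n})"
  proof
    fix q assume "q \<in> S l'"
    then obtain w x y z where "q = Quaternion w x y z" "{w, x, y, z} \<subseteq> {0..<n}"
      unfolding S_def by blast
    then show "q \<in> (\<Union>w\<in>{0..<n}. \<Union>x\<in>{0..<n}. \<Union>y\<in>{0..<n}. Quaternion w x y ` {0..<n})"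
      by (simp add: image_iff)
  qed
  then show "finite (S l')" by (rule finite_subset) simp
qed

text \<open>For nonzero elements, split off the common power: m1 = p^t a and m2 = p^t b with
  \<open>a\<close> and \<open>b\<close> prime to \<open>p\<close>. Then u = b/a modulo p^k
  works.\<close>

lemma residue_val_eq_imp_unit_multiple:
  assumes "prime p" and "m1 \<in> {0..<int p ^ k}" "m2 \<in> {0..<int p ^ k}"
    and val: "residue_val p k m1 = residue_val p k m2"
  shows "\<exists>u. \<not> int p dvd u \<and> [u * m1 = m2] (mod int p ^ k)"
proof -
  have p: "prime (int p)" using assms(1) by simp
  \<comment> \<open>Hence the value \<open>k\<close>, assigned to 0 by convention, is taken by no
    other residue, and 0 is paired only with itself.\<close>
  have mult: "multiplicity (int p) m < k" if "m \<in> {0..<int p ^ k}" "m \<noteq> 0" for m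
  proof (rule ccontr)
    assume "\<not> multiplicity (int p) m < k"
    then have "int p ^ k dvd m" by (simp add: multiplicity_dvd')
    with that show False using zdvd_imp_le[of "int p ^ k" m] by auto
  qed
  show ?thesis
  proof (cases "m1 = 0 \<or> m2 = 0")
    case True
    with assms mult[of m1] mult[of m2] have "m1 = 0" "m2 = 0"
      by (auto simp: residue_val_def split: if_splits)
    with p show ?thesis by (intro exI[of _ 1]) auto
  next
    case False
    define t where "t = multiplicity (int p) m1"
    have t2: "t = multiplicity (int p) m2"
      using False val by (simp add: residue_val_def t_def)
    obtain a where a: "m1 = int p ^ t * a" "\<not> int p dvd a"
      using multiplicity_decompose'[of m1 "int p"] False p unfolding t_def
      by (metis not_prime_unit)
    obtain b where b: "m2 = int p ^ t * b" "\<not> int p dvd b"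
      using multiplicity_decompose'[of m2 "int p"] False p unfolding t2
      by (metis not_prime_unit)
    have "coprime a (int p ^ k)"
      using prime_imp_power_coprime[OF p a(2)] by (simp add: coprime_commute)
    then obtain v where v: "[a * v = 1] (mod int p ^ k)"
      using cong_solve_coprime_int by blast
    \<comment> \<open>With \<open>k > 0\<close> the congruence for \<open>v\<close> descends to
      modulus \<open>p\<close>, which shows that \<open>v\<close> is prime to
      \<open>p\<close>.\<close>
    have "k > 0" using mult[of m1] False assms(2) by auto
    then have "[a * v = 1] (mod int p)" using v by (rule_tac cong_dvd_modulus) auto
    then have "\<not> int p dvd v"
      using p cong_dvd_iff[of "a * v" 1 "int p"] by auto
    then have "\<not> int p dvd b * v" using b(2) p by (simp add: prime_dvd_mult_iff)
    moreover have "[(b * v) * m1 = m2] (mod int p ^ k)"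
      using cong_scalar_left[OF v, of m2] by (simp add: a(1) b(1) mult_ac)
    ultimately show ?thesis by blast
  qed
qed

theorem theorem5p4:
  fixes p k :: nat and m1 m2 :: int
  assumes "prime p" and "odd p" and "k \<ge> 1"
    and "m1 \<in> carrier (residue_ring (int p ^ k))"
    and "m2 \<in> carrier (residue_ring (int p ^ k))"
    and "residue_val p k m1 = residue_val p k m2"
  shows "norm_count p k m1 = norm_count p k m2"
proof -
  have p: "prime (int p)" "odd (int p)" using assms by simp_all
  have gt1: "int p ^ k > 1" using assms(3) prime_gt_1_int[OF p(1)] by simp
  interpret residues "int p ^ k" "residue_ring (int p ^ k)"
    using gt1 by unfold_locales simp_all
  \<comment> \<open>Stated for arbitrary \<open>l\<close> and \<open>l'\<close> so that it applies
    to the two residues in either order.\<close>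
  have le: "norm_count p k l \<le> norm_count p k l'"
    if l: "l \<in> {0..<int p ^ k}" and l': "l' \<in> {0..<int p ^ k}"
      and val: "residue_val p k l = residue_val p k l'" for l l'
  proof -
    obtain u where u: "\<not> int p dvd u" "[u * l = l'] (mod int p ^ k)"
      using residue_val_eq_imp_unit_multiple[OF assms(1) l l' val] by blast
    obtain c d where cd: "[c\<^sup>2 + d\<^sup>2 = u] (mod int p ^ k)"
      using sum_two_squares_mod_prime_power[OF p u(1)] by blast
    have "coprime u (int p ^ k)"
      using prime_imp_power_coprime[OF p(1) u(1)] by (simp add: coprime_commute)
    then have "coprime (c\<^sup>2 + d\<^sup>2) (int p ^ k)"
      using cd by (metis cong_imp_coprime cong_sym)
    moreover have "[(c\<^sup>2 + d\<^sup>2) * l = l'] (mod int p ^ k)"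
      using cong_trans[OF cong_scalar_right[OF cd] u(2)] .
    ultimately show ?thesis
      unfolding norm_count_def quaternion_norm_set_eq
      using gt1 l' prime_gt_0_nat[OF assms(1)] by (intro card_norm_le_of_sum_two_squares) auto
  qed
  have "m1 \<in> {0..<int p ^ k}" "m2 \<in> {0..<int p ^ k}"
    using assms(4,5) by (auto simp: res_carrier_eq)
  with assms(6) show ?thesis by (intro antisym le) auto
qed

end
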